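(* Let $N$ be a positive integer. Every family of $A_N$-invariant tropical polynomials on $\mathbb{R}^N$ that separates $A_N$-orbits — in particular, every family of $A_N$-invariant tropical polynomials that generates the semifield of $A_N$-invariant tropical rational functions — contains a member of degree at least $\binom N2$. The bound is attained: the $N+1$ $A_N$-invariant tropical polynomials $\varepsilon_1,\dots,\varepsilon_N,f_{z^\ast}$ with $z^\ast=(0,1,\dots,N-1)$ separate $A_N$-orbits, and their degrees are at most $\max\{N,\binom N2\}$.
   Context: The alternating group $A_N\le S_N$ acts on $\mathbb{R}^N$ by permuting coordinates. $f_z(x):=\max_{g\in A_N}\langle x,g\cdot z\rangle$ is the $A_N$-trace with template $z$; $\varepsilon_k(x):=\max_{\#I=k}\sum_{i\in I}x_i$, the maximum over $I\subseteq\{1,\dots,N\}$ of size $k$. A family of invariant functions separates orbits if any two points at which all members agree lie in the same orbit. A tropical polynomial on $\mathbb{R}^m$ is a finite maximum $\max_j\ell_j$ of functions $\ell_j(z)=\gamma_j+\langle a_j,z\rangle$ with $\gamma_j\in\mathbb{R}$, $a_j\in\mathbb{Z}_{\ge0}^m$, regarded as a function; its degree is the smallest value, over all such representations, of $\max_j\|a_j\|_1$. A tropical rational function is a difference of two tropical polynomials, regarded as a function; these form a semifield under $\max$ (addition), $+$ (multiplication), $-$ (division). A family generates the semifield of $A_N$-invariant tropical rational functions if every such function equals $g(f_1,\dots,f_k)$ for some members $f_1,\dots,f_k$ and some tropical rational $g$ on $\mathbb{R}^k$. *)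

theory Defs
  imports Complex_Main "HOL-Algebra.Group_Action" "HOL-Algebra.Sym_Groups"
begin

text \<open>
  Dimensions vary within a single statement, so a point of \<open>\<real>\<^sup>m\<close> is an extensional function on
  the index set \<open>{1..m}\<close>, the set on which \<^const>\<open>alt_group\<close> acts. Likewise a function on
  \<open>\<real>\<^sup>m\<close> is extensional on \<open>Rspace m\<close>, so that equality in HOL is equality of functions on \<open>\<real>\<^sup>m\<close>.
\<close>

definition Rspace :: "nat \<Rightarrow> (nat \<Rightarrow> real) set" where
  "Rspace m = {1..m} \<rightarrow>\<^sub>E UNIV"

subsection \<open>The action of the alternating group\<close>

text \<open>The left action: \<open>perm_act g x\<close> carries the \<open>i\<close>-th coordinate of \<open>x\<close> to position \<open>g i\<close>.\<close>

definition perm_act :: "(nat \<Rightarrow> nat) \<Rightarrow> (nat \<Rightarrow> real) \<Rightarrow> (nat \<Rightarrow> real)" where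
  "perm_act g x = x \<circ> inv' g"

definition alt_invariant :: "nat \<Rightarrow> ((nat \<Rightarrow> real) \<Rightarrow> real) \<Rightarrow> bool" where
  "alt_invariant N f \<longleftrightarrow>
     (\<forall>g \<in> carrier (alt_group N). \<forall>x \<in> Rspace N. f (perm_act g x) = f x)"

definition separates_orbits :: "nat \<Rightarrow> ((nat \<Rightarrow> real) \<Rightarrow> real) set \<Rightarrow> bool" where
  "separates_orbits N F \<longleftrightarrow>
     (\<forall>x \<in> Rspace N. \<forall>y \<in> Rspace N.
        (\<forall>f \<in> F. f x = f y) \<longrightarrow> y \<in> orbit (alt_group N) perm_act x)"

subsection \<open>Tropical polynomials and rational functions\<close>

text \<open>
  A pair \<open>(\<gamma>, a)\<close> encodes the affine function \<open>\<gamma> + \<langle>a, z\<rangle>\<close>; only the values of \<open>a\<close> on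
  \<open>{1..m}\<close> are used. The maximum is meaningful for finite nonempty \<open>S\<close> only.
\<close>

definition trop_max :: "nat \<Rightarrow> (real \<times> (nat \<Rightarrow> nat)) set \<Rightarrow> (nat \<Rightarrow> real) \<Rightarrow> real" where
  "trop_max m S =
     (\<lambda>z \<in> Rspace m. Max ((\<lambda>(\<gamma>, a). \<gamma> + (\<Sum>i = 1..m. real (a i) * z i)) ` S))"

definition trop_poly :: "nat \<Rightarrow> ((nat \<Rightarrow> real) \<Rightarrow> real) \<Rightarrow> bool" where
  "trop_poly m f \<longleftrightarrow> (\<exists>S. finite S \<and> S \<noteq> {} \<and> f = trop_max m S)"

definition trop_degree :: "nat \<Rightarrow> ((nat \<Rightarrow> real) \<Rightarrow> real) \<Rightarrow> nat" where
  "trop_degree m f =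
     (LEAST d. \<exists>S. finite S \<and> S \<noteq> {} \<and> f = trop_max m S \<and>
                   d = Max ((\<lambda>(\<gamma>, a). \<Sum>i = 1..m. a i) ` S))"

definition trop_rational :: "nat \<Rightarrow> ((nat \<Rightarrow> real) \<Rightarrow> real) \<Rightarrow> bool" where
  "trop_rational m h \<longleftrightarrow>
     (\<exists>p q. trop_poly m p \<and> trop_poly m q \<and> h = (\<lambda>z \<in> Rspace m. p z - q z))"

definition generates_invariant_semifield :: "nat \<Rightarrow> ((nat \<Rightarrow> real) \<Rightarrow> real) set \<Rightarrow> bool" where
  "generates_invariant_semifield N F \<longleftrightarrow>
     (\<forall>h. trop_rational N h \<and> alt_invariant N h \<longrightarrow>
        (\<exists>k fs g. (\<forall>i \<in> {1..k}. fs i \<in> F) \<and> trop_rational k g \<and>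
           h = (\<lambda>x \<in> Rspace N. g (\<lambda>i \<in> {1..k}. fs i x))))"

definition alt_inv_trop_polys :: "nat \<Rightarrow> ((nat \<Rightarrow> real) \<Rightarrow> real) set" where
  "alt_inv_trop_polys N = {f. trop_poly N f \<and> alt_invariant N f}"

subsection \<open>The functions of the attaining family\<close>

definition alt_trace :: "nat \<Rightarrow> (nat \<Rightarrow> real) \<Rightarrow> (nat \<Rightarrow> real) \<Rightarrow> real" where
  "alt_trace N z =
     (\<lambda>x \<in> Rspace N. Max ((\<lambda>g. \<Sum>i = 1..N. x i * perm_act g z i) ` carrier (alt_group N)))"

definition trop_esym :: "nat \<Rightarrow> nat \<Rightarrow> (nat \<Rightarrow> real) \<Rightarrow> real" where
  "trop_esym N k =
     (\<lambda>x \<in> Rspace N. Max ((\<lambda>I. \<Sum>i\<in>I. x i) ` {I. I \<subseteq> {1..N} \<and> card I = k}))"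

definition z_star :: "nat \<Rightarrow> (nat \<Rightarrow> real)" where
  "z_star N = (\<lambda>i \<in> {1..N}. real i - 1)"

end

theory Submission
  imports Defs
begin

text \<open>
  \<^bold>\<open>Lower bound.\<close> An exponent vector in \<open>\<nat>\<^sup>N\<close> with pairwise distinct entries has sum at least
  \<open>0 + 1 + \<dots> + (N - 1) = N choose 2\<close>. In a tropical polynomial of smaller degree every monomial is
  therefore fixed by some transposition. If the polynomial is invariant under the alternating group,
  it is the maximum of its monomials over all even permutations of the argument; for such monomials
  this is the same as the maximum over all permutations, so the polynomial is invariant under the
  whole symmetric group (\<open>low_degree_imp_symmetric\<close>). For \<open>N \<ge> 2\<close>, a family of such functions cannot
  tell \<open>(1, 2, \<dots>, N)\<close> from its image under a transposition, and these two points lie in different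
  orbits.

  \<^bold>\<open>Generating families.\<close> The \<open>\<epsilon>\<^sub>k\<close> and the staircase trace are in particular invariant rational
  functions. Points on which a generating family agrees are not told apart by them either, so their
  separation property passes to every generating family.

  \<^bold>\<open>Separation.\<close> The value of \<open>\<epsilon>\<^sub>k\<close> is the sum of the \<open>k\<close> largest coordinates. Consecutive
  differences recover the decreasingly sorted point, that is, the orbit under the symmetric group
  (\<open>trop_esym_determines_symmetric_orbit\<close>). It remains to separate \<open>x\<close> from \<open>x \<circ> h\<close> with \<open>h\<close> odd.
  If two coordinates of \<open>x\<close> agree, \<open>h\<close> may be corrected by a transposition. Otherwise the trace
  with template \<open>(0, \<dots>, N - 1)\<close> maximises \<open>\<Sum>i. z i * x (g i)\<close> over the even \<open>g\<close> at \<open>x\<close>, and over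
  the odd \<open>g\<close> at \<open>x \<circ> h\<close>. By the rearrangement inequality only the permutation sorting \<open>x\<close>
  attains the maximum over all \<open>g\<close>; it has one parity only, so the two values differ.
\<close>

section \<open>The action of the alternating group\<close>

lemma Rspace_comp_permutes:
  assumes "x \<in> Rspace N" "p permutes {1..N}"
  shows "x \<circ> p \<in> Rspace N"
  using assms permutes_not_in[OF assms(2)] by (auto simp: Rspace_def PiE_def extensional_def)

lemma evenperm_comp_permutes:
  fixes p q :: "nat \<Rightarrow> nat"
  assumes "p permutes {1..N}" "q permutes {1..N}"
  shows "evenperm (p \<circ> q) \<longleftrightarrow> evenperm p = evenperm q"
  using assms by (intro evenperm_comp) (auto simp: permutation_permutes)

lemma evenperm_inv_permutes:
  fixes p :: "nat \<Rightarrow> nat"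
  assumes "p permutes {1..N}"
  shows "evenperm (inv' p) \<longleftrightarrow> evenperm p"
  using assms by (intro evenperm_inv) (auto simp: permutation_permutes)

text \<open>
  Since inversion permutes the alternating group, the left action through \<open>x \<circ> inv g\<close> may be traded
  for plain precomposition \<open>x \<circ> p\<close>, the form used from here on.
\<close>

lemma image_inv_alt_group: "inv' ` carrier (alt_group N) = carrier (alt_group N)"
proof (intro equalityI subsetI)
  fix p assume "p \<in> carrier (alt_group N)"
  then have "inv' p \<in> carrier (alt_group N)" "inv' (inv' p) = p"
    using permutes_inv_inv unfolding alt_group_carrier
    by (blast intro: permutes_inv iffD2[OF evenperm_inv_permutes])+
  then show "p \<in> inv' ` carrier (alt_group N)" by force
qed (auto intro: alt_group_inv_closed)

lemma alt_invariant_iff: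
  "alt_invariant N f \<longleftrightarrow>
     (\<forall>p. p permutes {1..N} \<and> evenperm p \<longrightarrow> (\<forall>x \<in> Rspace N. f (x \<circ> p) = f x))"
proof -
  have "alt_invariant N f \<longleftrightarrow> (\<forall>p \<in> inv' ` carrier (alt_group N). \<forall>x \<in> Rspace N. f (x \<circ> p) = f x)"
    by (simp add: alt_invariant_def perm_act_def)
  then show ?thesis unfolding image_inv_alt_group alt_group_carrier[symmetric] by blast
qed

lemma orbit_alt_group_iff:
  "y \<in> orbit (alt_group N) perm_act x \<longleftrightarrow> (\<exists>p. p permutes {1..N} \<and> evenperm p \<and> y = x \<circ> p)"
proof -
  have "y \<in> orbit (alt_group N) perm_act x \<longleftrightarrow> (\<exists>p \<in> inv' ` carrier (alt_group N). y = x \<circ> p)"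
    by (auto simp: orbit_def perm_act_def)
  then show ?thesis unfolding image_inv_alt_group by (auto simp: alt_group_carrier)
qed

section \<open>Tropical polynomials of low degree\<close>

lemma trop_max_ge:
  assumes "finite S" "(\<gamma>, a) \<in> S" "x \<in> Rspace m"
  shows "\<gamma> + (\<Sum>i = 1..m. real (a i) * x i) \<le> trop_max m S x"
  using assms unfolding trop_max_def by (auto intro!: Max_ge image_eqI[where x = "(\<gamma>, a)"])

lemma trop_max_attained:
  assumes "finite S" "S \<noteq> {}" "x \<in> Rspace m"
  obtains \<gamma> a where "(\<gamma>, a) \<in> S" "trop_max m S x = \<gamma> + (\<Sum>i = 1..m. real (a i) * x i)"
proof -
  have "trop_max m S x \<in> (\<lambda>(\<gamma>, a). \<gamma> + (\<Sum>i = 1..m. real (a i) * x i)) ` S"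
    using assms Max_in[of "(\<lambda>(\<gamma>, a). \<gamma> + (\<Sum>i = 1..m. real (a i) * x i)) ` S"]
    unfolding trop_max_def by simp
  then show ?thesis using that by auto
qed

lemma trop_poly_degree_representation:
  assumes "trop_poly m f"
  obtains S where "finite S" "S \<noteq> {}" "f = trop_max m S"
    "\<And>\<gamma> a. (\<gamma>, a) \<in> S \<Longrightarrow> (\<Sum>i = 1..m. a i) \<le> trop_degree m f"
proof -
  let ?P = "\<lambda>d. \<exists>S. finite S \<and> S \<noteq> {} \<and> f = trop_max m S \<and>
                   d = Max ((\<lambda>(\<gamma>, a). \<Sum>i = 1..m. a i) ` S)"
  have "\<exists>d. ?P d" using assms unfolding trop_poly_def by blast
  then have "?P (trop_degree m f)" unfolding trop_degree_def by (rule LeastI_ex)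
  then obtain S where S: "finite S" "S \<noteq> {}" "f = trop_max m S"
    and d: "trop_degree m f = Max ((\<lambda>(\<gamma>, a). \<Sum>i = 1..m. a i) ` S)" by blast
  have "(\<Sum>i = 1..m. a i) \<le> trop_degree m f" if "(\<gamma>, a) \<in> S" for \<gamma> a
    unfolding d using S(1) that by (auto intro!: Max_ge image_eqI[where x = "(\<gamma>, a)"])
  then show ?thesis using S that by blast
qed

lemma trop_degree_le:
  assumes "finite S" "S \<noteq> {}" "f = trop_max m S"
    and deg: "\<And>\<gamma> a. (\<gamma>, a) \<in> S \<Longrightarrow> (\<Sum>i = 1..m. a i) \<le> d"
  shows "trop_degree m f \<le> d"
proof -
  let ?d = "Max ((\<lambda>(\<gamma>, a). \<Sum>i = 1..m. a i) ` S)"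
  have "trop_degree m f \<le> ?d"
    unfolding trop_degree_def using assms(1-3) by (intro Least_le) blast
  also have "?d \<le> d" using assms(1,2) deg by auto
  finally show ?thesis .
qed

text \<open>
  The function attached to a set of exponent vectors is a maximum of affine functions with zero
  constant terms; both kinds of functions in the attaining family have this form.
\<close>

lemma trop_max_homogeneous:
  assumes "x \<in> Rspace m"
  shows "trop_max m (Pair 0 ` A) x = Max ((\<lambda>a. \<Sum>i = 1..m. real (a i) * x i) ` A)"
  using assms by (simp add: trop_max_def image_image)

text \<open>Among sets of \<open>N\<close> natural numbers, \<open>{0, \<dots>, N - 1}\<close> has the least sum.\<close>

lemma choose_two_le_sum_of_distinct:
  fixes a :: "nat \<Rightarrow> nat"
  assumes "inj_on a {1..N}"
  shows "N choose 2 \<le> (\<Sum>i = 1..N. a i)"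
proof -
  have "N choose 2 = \<Sum>{0..<N}"
    using Sum_Ico_nat[of 0 N] by (simp add: choose_two)
  also have "\<dots> \<le> \<Sum>(a ` {1..N})"
    using card_sum_le_nat_sum[of "a ` {1..N}"] assms by (simp add: card_image)
  also have "\<dots> = (\<Sum>i = 1..N. a i)"
    using assms by (simp add: sum.reindex)
  finally show ?thesis .
qed

text \<open>
  The monomial that attains the maximum at \<open>x\<close> has a repeated exponent, hence takes the same value at
  \<open>x \<circ> \<tau>\<close> for the transposition \<open>\<tau>\<close> of the two positions. When \<open>p\<close> is odd, \<open>x \<circ> \<tau>\<close> and \<open>x \<circ> p\<close> lie
  in one orbit of the alternating group.
\<close>

lemma low_degree_le_permuted:
  assumes "trop_poly N f" "alt_invariant N f" "trop_degree N f < N choose 2"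
    and x: "x \<in> Rspace N" and p: "p permutes {1..N}"
  shows "f x \<le> f (x \<circ> p)"
proof (cases "evenperm p")
  case True
  then show ?thesis using assms by (simp add: alt_invariant_iff)
next
  case odd: False
  obtain S where S: "finite S" "S \<noteq> {}" "f = trop_max N S"
    "\<And>\<gamma> a. (\<gamma>, a) \<in> S \<Longrightarrow> (\<Sum>i = 1..N. a i) \<le> trop_degree N f"
    using trop_poly_degree_representation[OF assms(1)] by blast
  obtain \<gamma> a where a: "(\<gamma>, a) \<in> S" "f x = \<gamma> + (\<Sum>i = 1..N. real (a i) * x i)"
    using trop_max_attained[OF S(1,2) x] S(3) by metis
  have "\<not> inj_on a {1..N}"
    using choose_two_le_sum_of_distinct[of a N] S(4)[OF a(1)] assms(3) by linarith
  then obtain i j where ij: "i \<in> {1..N}" "j \<in> {1..N}" "i \<noteq> j" "a i = a j"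
    unfolding inj_on_def by blast
  define \<tau> where "\<tau> = Transposition.transpose i j"
  have \<tau>: "\<tau> permutes {1..N}" "\<not> evenperm \<tau>" "\<tau> \<circ> \<tau> = id"
    using ij by (auto simp: \<tau>_def permutes_swap_id evenperm_swap)
  have a\<tau>: "a (\<tau> k) = a k" for k
    using ij(4) by (auto simp: \<tau>_def Transposition.transpose_def)
  have "f x = \<gamma> + (\<Sum>k = 1..N. real (a (\<tau> k)) * x (\<tau> k))"
    unfolding a(2) using sum.permute[OF \<tau>(1), of "\<lambda>k. real (a k) * x k"] by (simp add: o_def)
  also have "\<dots> = \<gamma> + (\<Sum>k = 1..N. real (a k) * (x \<circ> \<tau>) k)"
    by (simp add: a\<tau>)
  also have "\<dots> \<le> f (x \<circ> \<tau>)"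
    unfolding S(3) using S(1) a(1) Rspace_comp_permutes[OF x \<tau>(1)] by (rule trop_max_ge)
  finally have "f x \<le> f (x \<circ> \<tau>)" .
  have "f (x \<circ> \<tau> \<circ> (\<tau> \<circ> p)) = f (x \<circ> \<tau>)"
    using assms(2) Rspace_comp_permutes[OF x \<tau>(1)] permutes_compose[OF p \<tau>(1)]
      evenperm_comp_permutes[OF \<tau>(1) p] odd \<tau>(2)
    unfolding alt_invariant_iff by blast
  moreover have "x \<circ> \<tau> \<circ> (\<tau> \<circ> p) = x \<circ> p"
    using \<tau>(3) by (simp add: fun_eq_iff)
  ultimately show ?thesis using \<open>f x \<le> f (x \<circ> \<tau>)\<close> by simp
qed

lemma low_degree_imp_symmetric:
  assumes "trop_poly N f" "alt_invariant N f" "trop_degree N f < N choose 2"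
    and x: "x \<in> Rspace N" and p: "p permutes {1..N}"
  shows "f (x \<circ> p) = f x"
proof (rule antisym)
  have "x \<circ> p \<circ> inv' p = x"
    using permutes_inv_o(1)[OF p] by (simp add: comp_assoc)
  then show "f (x \<circ> p) \<le> f x"
    using low_degree_le_permuted[OF assms(1-3) Rspace_comp_permutes[OF x p] permutes_inv[OF p]]
    by simp
  show "f x \<le> f (x \<circ> p)"
    by (rule low_degree_le_permuted[OF assms])
qed

lemma separating_family_has_high_degree:
  assumes "N > 0" "F \<subseteq> alt_inv_trop_polys N" "separates_orbits N F"
  shows "\<exists>f \<in> F. N choose 2 \<le> trop_degree N f"
proof (rule ccontr)
  assume "\<not> (\<exists>f \<in> F. N choose 2 \<le> trop_degree N f)"
  then have low: "trop_degree N f < N choose 2" if "f \<in> F" for f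
    using that by (simp add: not_le)
  define x :: "nat \<Rightarrow> real" where "x = (\<lambda>i \<in> {1..N}. real i)"
  have x: "x \<in> Rspace N" by (simp add: x_def Rspace_def)
  show False
  proof (cases "N = 1")
    case True
    (* Here N choose 2 = 0, so the family would be empty, and the line has more than one point. *)
    have "F = {}" using low True by (auto simp: binomial_eq_0)
    define y :: "nat \<Rightarrow> real" where "y = (\<lambda>i \<in> {1..N}. 0)"
    have "y \<in> Rspace N" by (simp add: y_def Rspace_def)
    then obtain p where p: "p permutes {1..N}" "y = x \<circ> p"
      using assms(3) x \<open>F = {}\<close> unfolding separates_orbits_def orbit_alt_group_iff by blast
    then have "y 1 = x 1" using True by simp
    then show False using True by (simp add: x_def y_def)
  next
    case False
    define \<tau> where "\<tau> = Transposition.transpose 1 (2 :: nat)"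
    have \<tau>: "\<tau> permutes {1..N}" "\<not> evenperm \<tau>"
      using False assms(1) by (auto simp: \<tau>_def permutes_swap_id evenperm_swap)
    have "f x = f (x \<circ> \<tau>)" if "f \<in> F" for f
      using low_degree_imp_symmetric[OF _ _ low[OF that] x \<tau>(1)] assms(2) that
      by (auto simp: alt_inv_trop_polys_def)
    then obtain p where p: "p permutes {1..N}" "evenperm p" "x \<circ> \<tau> = x \<circ> p"
      using assms(3) x Rspace_comp_permutes[OF x \<tau>(1)]
      unfolding separates_orbits_def orbit_alt_group_iff by blast
    have "\<tau> i = p i" for i
    proof (cases "i \<in> {1..N}")
      case True
      then have "\<tau> i \<in> {1..N}" "p i \<in> {1..N}"
        using permutes_in_image[OF \<tau>(1)] permutes_in_image[OF p(1)] by blast+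
      then show ?thesis using fun_cong[OF p(3), of i] by (simp add: x_def)
    next
      case False
      then show ?thesis using permutes_not_in[OF \<tau>(1)] permutes_not_in[OF p(1)] by simp
    qed
    then have "\<tau> = p" by blast
    then show False using \<tau>(2) p(2) by simp
  qed
qed

section \<open>The rearrangement inequality\<close>

lemma sum_mult_transpose:
  fixes z x :: "nat \<Rightarrow> real"
  assumes "finite A" "i \<in> A" "j \<in> A" "i \<noteq> j"
  shows "(\<Sum>k\<in>A. z k * x (Transposition.transpose i j k)) =
         (\<Sum>k\<in>A. z k * x k) + (z j - z i) * (x i - x j)"
proof -
  have split: "sum f A = f i + f j + sum f (A - {i} - {j})" for f :: "nat \<Rightarrow> real"
    using assms by (simp add: sum.remove[of A i] sum.remove[of "A - {i}" j])
  have "(\<Sum>k\<in>A - {i} - {j}. z k * x (Transposition.transpose i j k)) = (\<Sum>k\<in>A - {i} - {j}. z k * x k)"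
    by (rule sum.cong) auto
  then show ?thesis
    unfolding split[of "\<lambda>k. z k * x (Transposition.transpose i j k)"] split[of "\<lambda>k. z k * x k"]
    by (simp add: algebra_simps)
qed

text \<open>Swapping two positions that are in the wrong order would increase the sum.\<close>

lemma rearrangement_maximizer_sorted:
  fixes z x :: "nat \<Rightarrow> real"
  assumes "finite A" and \<sigma>: "\<sigma> permutes A"
    and max: "\<And>\<rho>. \<rho> permutes A \<Longrightarrow> (\<Sum>k\<in>A. z k * x (\<rho> k)) \<le> (\<Sum>k\<in>A. z k * x (\<sigma> k))"
    and ij: "i \<in> A" "j \<in> A" "z i < z j"
  shows "x (\<sigma> i) \<le> x (\<sigma> j)"
proof -
  have "i \<noteq> j" using ij by auto
  have "\<sigma> \<circ> Transposition.transpose i j permutes A"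
    using permutes_compose[OF permutes_swap_id[OF ij(1,2)] \<sigma>] .
  from max[OF this] have "(z j - z i) * (x (\<sigma> i) - x (\<sigma> j)) \<le> 0"
    using sum_mult_transpose[OF assms(1) ij(1,2) \<open>i \<noteq> j\<close>, of z "x \<circ> \<sigma>"] by simp
  then show ?thesis using ij(3) by (simp add: mult_le_0_iff)
qed

text \<open>The sorting permutation is found as a maximiser for the decreasing weights \<open>-i\<close>.\<close>

lemma exists_decreasing_arrangement:
  fixes x :: "nat \<Rightarrow> real"
  obtains \<pi> where "\<pi> permutes {1..N}"
    "\<And>i j. i \<in> {1..N} \<Longrightarrow> j \<in> {1..N} \<Longrightarrow> i \<le> j \<Longrightarrow> x (\<pi> j) \<le> x (\<pi> i)"
proof -
  let ?val = "\<lambda>\<sigma>. \<Sum>k = 1..N. - real k * x (\<sigma> k)"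
  let ?P = "{\<sigma>. \<sigma> permutes {1..N}}"
  have fin: "finite ?P" by (simp add: finite_permutations)
  have "?P \<noteq> {}" using permutes_id by blast
  then have "Max (?val ` ?P) \<in> ?val ` ?P"
    using fin by (intro Max_in) simp_all
  then obtain \<pi> where \<pi>: "\<pi> permutes {1..N}" "Max (?val ` ?P) = ?val \<pi>" by blast
  have max: "?val \<rho> \<le> ?val \<pi>" if "\<rho> permutes {1..N}" for \<rho>
    unfolding \<pi>(2)[symmetric] using fin that by (intro Max_ge) auto
  have "x (\<pi> j) \<le> x (\<pi> i)" if "i \<in> {1..N}" "j \<in> {1..N}" "i \<le> j" for i j
  proof (cases "i = j")
    case False
    then show ?thesis
      using rearrangement_maximizer_sorted[of "{1..N}" \<pi> "\<lambda>k. - real k" x j i] \<pi>(1) max that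
      by auto
  qed simp
  then show ?thesis using \<pi>(1) that by blast
qed

lemma strict_mono_permutes_eq_id:
  fixes p :: "nat \<Rightarrow> nat"
  assumes p: "p permutes {1..N}"
    and mono: "\<And>i j. i \<in> {1..N} \<Longrightarrow> j \<in> {1..N} \<Longrightarrow> i < j \<Longrightarrow> p i < p j"
  shows "p = id"
proof (rule permutes_natset_ge[OF p])
  have "i \<le> p i" if "i \<in> {1..N}" for i
    using that
  proof (induction i)
    case (Suc i)
    show ?case
    proof (cases "i = 0")
      case True
      then show ?thesis using Suc.prems permutes_in_image[OF p, of "Suc i"] by simp
    next
      case False
      then show ?thesis using Suc mono[of i "Suc i"] by simp
    qed
  qed simp
  then show "\<forall>i \<in> {1..N}. i \<le> p i" by blast
qed

text \<open>
  Passing from one strictly increasing arrangement to the other is a permutation of \<open>{1..N}\<close> that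
  preserves the order, hence the identity.
\<close>

lemma strictly_increasing_arrangement_unique:
  fixes x :: "nat \<Rightarrow> real"
  assumes \<sigma>: "\<sigma> permutes {1..N}" and \<rho>: "\<rho> permutes {1..N}"
    and \<sigma>_mono: "\<And>i j. i \<in> {1..N} \<Longrightarrow> j \<in> {1..N} \<Longrightarrow> i < j \<Longrightarrow> x (\<sigma> i) < x (\<sigma> j)"
    and \<rho>_mono: "\<And>i j. i \<in> {1..N} \<Longrightarrow> j \<in> {1..N} \<Longrightarrow> i < j \<Longrightarrow> x (\<rho> i) < x (\<rho> j)"
  shows "\<sigma> = \<rho>"
proof -
  define p where "p = inv' \<sigma> \<circ> \<rho>"
  have p: "p permutes {1..N}"
    unfolding p_def using \<rho> permutes_inv[OF \<sigma>] by (rule permutes_compose)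
  have \<sigma>p: "\<sigma> (p i) = \<rho> i" for i
    by (simp add: p_def permutes_inverses[OF \<sigma>])
  have "p i < p j" if ij: "i \<in> {1..N}" "j \<in> {1..N}" "i < j" for i j
  proof (rule ccontr)
    assume "\<not> p i < p j"
    moreover have "p i \<in> {1..N}" "p j \<in> {1..N}"
      using ij permutes_in_image[OF p] by blast+
    ultimately have "x (\<sigma> (p j)) \<le> x (\<sigma> (p i))"
      using \<sigma>_mono[of "p j" "p i"] by (cases "p i = p j") auto
    then show False using \<rho>_mono[OF ij] by (simp add: \<sigma>p)
  qed
  then have "p = id" using strict_mono_permutes_eq_id[OF p] by blast
  then show ?thesis using \<sigma>p by (auto simp: fun_eq_iff)
qed

section \<open>Tropical elementary symmetric functions\<close>

lemma finite_subsets_of_card: "finite {I. I \<subseteq> {1..N :: nat} \<and> card I = k}"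
  by (rule finite_subset[of _ "Pow {1..N}"]) auto

lemma trop_esym_permute:
  assumes x: "x \<in> Rspace N" and p: "p permutes {1..N}"
  shows "trop_esym N k (x \<circ> p) = trop_esym N k x"
proof -
  let ?K = "{I. I \<subseteq> {1..N} \<and> card I = k}"
  have in_K: "q ` I \<in> ?K" if "q permutes {1..N}" "I \<in> ?K" for q I
  proof -
    have "q ` I \<subseteq> {1..N}"
      using that(2) permutes_image[OF that(1)] by blast
    then show ?thesis
      using that(2) card_image[OF permutes_inj_on[OF that(1)]] by blast
  qed
  have image_K: "(\<lambda>I. p ` I) ` ?K = ?K"
  proof (rule antisym; rule subsetI)
    fix I assume I: "I \<in> ?K"
    have "I = p ` (inv' p ` I)"
      by (simp add: image_image permutes_inverses(1)[OF p])
    then show "I \<in> (\<lambda>I. p ` I) ` ?K"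
      using in_K[OF permutes_inv[OF p] I] by (rule image_eqI)
  next
    fix J assume "J \<in> (\<lambda>I. p ` I) ` ?K"
    then show "J \<in> ?K" using in_K[OF p] by (elim imageE) simp
  qed
  have "(\<Sum>i\<in>I. (x \<circ> p) i) = (\<Sum>i\<in>p ` I. x i)" for I
    using permutes_inj_on[OF p, of I] by (simp add: sum.reindex)
  then have "(\<lambda>I. \<Sum>i\<in>I. (x \<circ> p) i) ` ?K = (\<lambda>I. \<Sum>i\<in>I. x i) ` (\<lambda>I. p ` I) ` ?K"
    by (simp only: image_image)
  then have "(\<lambda>I. \<Sum>i\<in>I. (x \<circ> p) i) ` ?K = (\<lambda>I. \<Sum>i\<in>I. x i) ` ?K"
    by (simp only: image_K)
  then show ?thesis
    using x Rspace_comp_permutes[OF x p] by (simp add: trop_esym_def)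
qed

text \<open>
  Outside the common part of \<open>I\<close> and \<open>{1..k}\<close>, the two sums have equally many terms, those of the
  first at most \<open>u k\<close> and those of the second at least \<open>u k\<close>.
\<close>

lemma trop_esym_decreasing:
  assumes u: "u \<in> Rspace N" and k: "k \<in> {1..N}"
    and dec: "\<And>i j. i \<in> {1..N} \<Longrightarrow> j \<in> {1..N} \<Longrightarrow> i \<le> j \<Longrightarrow> u j \<le> u i"
  shows "trop_esym N k u = (\<Sum>i = 1..k. u i)"
proof -
  let ?K = "{I. I \<subseteq> {1..N} \<and> card I = k}"
  have le: "(\<Sum>i\<in>I. u i) \<le> (\<Sum>i = 1..k. u i)" if I: "I \<in> ?K" for I
  proof -
    have fin: "finite I" using I finite_subset by blast
    have card: "card (I - {1..k}) = card ({1..k} - I)"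
      using card_Diff_subset_Int[of I "{1..k}"] card_Diff_subset_Int[of "{1..k}" I] fin I
      by (simp add: Int_commute)
    have "(\<Sum>i\<in>I. u i) = (\<Sum>i\<in>I \<inter> {1..k}. u i) + (\<Sum>i\<in>I - {1..k}. u i)"
      using sum.Int_Diff[OF fin] .
    also have "(\<Sum>i\<in>I - {1..k}. u i) \<le> of_nat (card (I - {1..k})) * u k"
      using I k by (intro sum_bounded_above dec) auto
    also have "\<dots> = of_nat (card ({1..k} - I)) * u k"
      by (simp only: card)
    also have "\<dots> \<le> (\<Sum>i\<in>{1..k} - I. u i)"
      using k by (intro sum_bounded_below dec) auto
    also have "(\<Sum>i\<in>I \<inter> {1..k}. u i) + (\<Sum>i\<in>{1..k} - I. u i) = (\<Sum>i = 1..k. u i)"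
      using sum.Int_Diff[of "{1..k}" u I] by (simp add: Int_commute)
    finally show ?thesis by simp
  qed
  have "Max ((\<lambda>I. \<Sum>i\<in>I. u i) ` ?K) = (\<Sum>i = 1..k. u i)"
    using le k finite_subsets_of_card
    by (intro Max_eqI) (auto intro!: image_eqI[where x = "{1..k}"])
  then show ?thesis using u by (simp add: trop_esym_def)
qed

lemma trop_esym_determines_symmetric_orbit:
  assumes x: "x \<in> Rspace N" and y: "y \<in> Rspace N"
    and eq: "\<And>k. k \<in> {1..N} \<Longrightarrow> trop_esym N k x = trop_esym N k y"
  obtains h where "h permutes {1..N}" "y = x \<circ> h"
proof -
  obtain \<pi> where \<pi>: "\<pi> permutes {1..N}"
    "\<And>i j. i \<in> {1..N} \<Longrightarrow> j \<in> {1..N} \<Longrightarrow> i \<le> j \<Longrightarrow> x (\<pi> j) \<le> x (\<pi> i)"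
    using exists_decreasing_arrangement by metis
  obtain \<rho> where \<rho>: "\<rho> permutes {1..N}"
    "\<And>i j. i \<in> {1..N} \<Longrightarrow> j \<in> {1..N} \<Longrightarrow> i \<le> j \<Longrightarrow> y (\<rho> j) \<le> y (\<rho> i)"
    using exists_decreasing_arrangement by metis
  have sums: "(\<Sum>i = 1..k. x (\<pi> i)) = (\<Sum>i = 1..k. y (\<rho> i))" if k: "k \<le> N" for k
  proof (cases "k = 0")
    case False
    then have k': "k \<in> {1..N}" using k by simp
    have "(\<Sum>i = 1..k. (x \<circ> \<pi>) i) = trop_esym N k (x \<circ> \<pi>)"
      using trop_esym_decreasing[OF Rspace_comp_permutes[OF x \<pi>(1)] k'] \<pi>(2) by simp
    also have "\<dots> = trop_esym N k (y \<circ> \<rho>)"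
      using eq[OF k'] trop_esym_permute[OF x \<pi>(1)] trop_esym_permute[OF y \<rho>(1)] by simp
    also have "\<dots> = (\<Sum>i = 1..k. (y \<circ> \<rho>) i)"
      using trop_esym_decreasing[OF Rspace_comp_permutes[OF y \<rho>(1)] k'] \<rho>(2) by simp
    finally show ?thesis by simp
  qed simp
  have "x (\<pi> i) = y (\<rho> i)" for i
  proof (cases "i \<in> {1..N}")
    case True
    then obtain m where "i = Suc m" by (cases i) auto
    then show ?thesis using sums[of i] sums[of m] True by simp
  next
    case False
    then show ?thesis
      using x y permutes_not_in[OF \<pi>(1) False] permutes_not_in[OF \<rho>(1) False]
      by (auto simp: Rspace_def PiE_def extensional_def)
  qed
  then have "y = x \<circ> (\<pi> \<circ> inv' \<rho>)"
    using permutes_inverses(1)[OF \<rho>(1)] by (auto simp: fun_eq_iff)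
  moreover have "\<pi> \<circ> inv' \<rho> permutes {1..N}"
    using permutes_inv[OF \<rho>(1)] \<pi>(1) by (rule permutes_compose)
  ultimately show ?thesis using that by blast
qed

lemma trop_esym_eq_trop_max:
  "trop_esym N k =
     trop_max N (Pair 0 ` (\<lambda>I i. if i \<in> I then 1 else 0) ` {I. I \<subseteq> {1..N} \<and> card I = k})"
  (is "_ = trop_max N (Pair 0 ` ?A)")
proof
  fix x
  show "trop_esym N k x = trop_max N (Pair 0 ` ?A) x"
  proof (cases "x \<in> Rspace N")
    case True
    have "(\<Sum>i = 1..N. real (if i \<in> I then 1 else 0) * x i) = (\<Sum>i\<in>I. x i)"
      if "I \<subseteq> {1..N}" for I
      using that
      by (intro sum.mono_neutral_cong_right) auto
    then have "(\<lambda>I. \<Sum>i\<in>I. x i) ` {I. I \<subseteq> {1..N} \<and> card I = k} =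
        (\<lambda>I. \<Sum>i = 1..N. real (if i \<in> I then 1 else 0) * x i) ` {I. I \<subseteq> {1..N} \<and> card I = k}"
      by (intro image_cong) auto
    then show ?thesis
      unfolding trop_max_homogeneous[OF True] using True
      by (simp only: trop_esym_def restrict_apply' image_image)
  qed (simp add: trop_esym_def trop_max_def)
qed

lemma trop_esym_poly_invariant_degree:
  assumes "k \<in> {1..N}"
  shows "trop_esym N k \<in> alt_inv_trop_polys N" "trop_degree N (trop_esym N k) \<le> N"
proof -
  let ?K = "{I. I \<subseteq> {1..N} \<and> card I = k}"
  let ?S = "Pair (0 :: real) ` (\<lambda>I i. if i \<in> I then 1 else (0 :: nat)) ` ?K"
  have "{1..k} \<in> ?K" using assms by simp
  then have "?K \<noteq> {}" by (metis empty_iff)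
  then have S: "finite ?S" "?S \<noteq> {}"
    by (simp_all only: image_is_empty finite_imageI finite_subsets_of_card not_False_eq_True)
  have "trop_poly N (trop_esym N k)"
    unfolding trop_poly_def
    by (rule exI[of _ ?S], rule conjI[OF S(1) conjI[OF S(2) trop_esym_eq_trop_max]])
  moreover have "alt_invariant N (trop_esym N k)"
    unfolding alt_invariant_iff by (intro allI impI ballI, elim conjE, rule trop_esym_permute)
  ultimately show "trop_esym N k \<in> alt_inv_trop_polys N"
    by (simp add: alt_inv_trop_polys_def)
  have "(\<Sum>i = 1..N. a i) \<le> N" if "(\<gamma>, a) \<in> ?S" for \<gamma> a
  proof -
    have "a i \<le> 1" for i using that by (elim imageE) simp
    then show ?thesis using sum_bounded_above[of "{1..N}" a 1] by simp
  qed
  then show "trop_degree N (trop_esym N k) \<le> N"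
    by (rule trop_degree_le[OF S trop_esym_eq_trop_max])
qed

section \<open>The trace with the staircase template\<close>

lemma finite_alt_group: "finite (carrier (alt_group N))"
  by (rule finite_subset[OF _ finite_permutations[of "{1..N}"]]) (auto simp: alt_group_carrier)

lemma id_in_alt_group: "id \<in> carrier (alt_group N)"
  by (simp add: alt_group_carrier)

lemma alt_trace_eq:
  assumes "x \<in> Rspace N"
  shows "alt_trace N z x = Max ((\<lambda>g. \<Sum>i = 1..N. z i * x (g i)) ` carrier (alt_group N))"
proof -
  have "(\<Sum>i = 1..N. x i * perm_act g z i) = (\<Sum>i = 1..N. z i * x (g i))"
    if "g \<in> carrier (alt_group N)" for g
  proof -
    have g: "g permutes {1..N}" using that by (simp add: alt_group_carrier)
    show ?thesis
      using sum.permute[OF g, of "\<lambda>i. x i * perm_act g z i"]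
      by (simp add: perm_act_def permutes_inverses[OF g] mult.commute)
  qed
  then show ?thesis using assms by (simp add: alt_trace_def cong: image_cong_simp)
qed

lemma alt_trace_ge:
  assumes "x \<in> Rspace N" "g permutes {1..N}" "evenperm g"
  shows "(\<Sum>i = 1..N. z i * x (g i)) \<le> alt_trace N z x"
  unfolding alt_trace_eq[OF assms(1)] using assms finite_alt_group
  by (intro Max_ge) (auto simp: alt_group_carrier)

lemma alt_trace_attained:
  assumes "x \<in> Rspace N"
  obtains g where "g permutes {1..N}" "evenperm g"
    "alt_trace N z x = (\<Sum>i = 1..N. z i * x (g i))"
proof -
  have "alt_trace N z x \<in> (\<lambda>g. \<Sum>i = 1..N. z i * x (g i)) ` carrier (alt_group N)"
    unfolding alt_trace_eq[OF assms] using finite_alt_group id_in_alt_group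
    by (intro Max_in) auto
  then show ?thesis using that by (auto simp: alt_group_carrier)
qed

lemma alt_trace_invariant: "alt_invariant N (alt_trace N z)"
proof -
  have le: "alt_trace N z (x \<circ> p) \<le> alt_trace N z x"
    if x: "x \<in> Rspace N" and p: "p permutes {1..N}" "evenperm p" for x p
  proof -
    obtain g where g: "g permutes {1..N}" "evenperm g"
      "alt_trace N z (x \<circ> p) = (\<Sum>i = 1..N. z i * (x \<circ> p) (g i))"
      using alt_trace_attained[OF Rspace_comp_permutes[OF x p(1)]] by blast
    then show ?thesis
      using alt_trace_ge[OF x permutes_compose[OF g(1) p(1)], of z] p
      by (simp add: evenperm_comp_permutes)
  qed
  have "alt_trace N z (x \<circ> p) = alt_trace N z x"
    if x: "x \<in> Rspace N" and p: "p permutes {1..N}" "evenperm p" for x p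
  proof (rule antisym[OF le[OF that]])
    have "alt_trace N z (x \<circ> p \<circ> inv' p) \<le> alt_trace N z (x \<circ> p)"
      using x p by (intro le) (auto simp: Rspace_comp_permutes permutes_inv evenperm_inv_permutes)
    moreover have "x \<circ> p \<circ> inv' p = x"
      using permutes_inv_o(1)[OF p(1)] by (simp add: comp_assoc)
    ultimately show "alt_trace N z x \<le> alt_trace N z (x \<circ> p)" by simp
  qed
  then show ?thesis by (simp add: alt_invariant_iff)
qed

lemma alt_trace_z_star_eq_trop_max:
  "alt_trace N (z_star N) =
     trop_max N (Pair 0 ` (\<lambda>g i. inv' g i - 1) ` carrier (alt_group N))"
  (is "_ = trop_max N (Pair 0 ` ?A)")
proof
  fix x
  show "alt_trace N (z_star N) x = trop_max N (Pair 0 ` ?A) x"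
  proof (cases "x \<in> Rspace N")
    case True
    have "x i * perm_act g (z_star N) i = real (inv' g i - 1) * x i"
      if "g \<in> carrier (alt_group N)" "i \<in> {1..N}" for g i
    proof -
      have "inv' g permutes {1..N}" using that(1) permutes_inv by (auto simp: alt_group_carrier)
      then have "inv' g i \<in> {1..N}" using that(2) permutes_in_image by metis
      then show ?thesis by (simp add: perm_act_def z_star_def of_nat_diff)
    qed
    then have "(\<lambda>g. \<Sum>i = 1..N. x i * perm_act g (z_star N) i) ` carrier (alt_group N) =
        (\<lambda>g. \<Sum>i = 1..N. real (inv' g i - 1) * x i) ` carrier (alt_group N)"
      by (intro image_cong sum.cong refl) auto
    then show ?thesis
      unfolding trop_max_homogeneous[OF True] using True
      by (simp only: alt_trace_def restrict_apply' image_image)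
  qed (simp add: alt_trace_def trop_max_def)
qed

lemma alt_trace_z_star_poly_invariant_degree:
  "alt_trace N (z_star N) \<in> alt_inv_trop_polys N"
  "trop_degree N (alt_trace N (z_star N)) \<le> N choose 2"
proof -
  let ?S = "Pair (0 :: real) ` (\<lambda>g i. inv' g i - 1) ` carrier (alt_group N)"
  have S: "finite ?S" "?S \<noteq> {}"
    using finite_alt_group id_in_alt_group by auto
  have "trop_poly N (alt_trace N (z_star N))"
    unfolding trop_poly_def
    by (rule exI[of _ ?S], rule conjI[OF S(1) conjI[OF S(2) alt_trace_z_star_eq_trop_max]])
  then show "alt_trace N (z_star N) \<in> alt_inv_trop_polys N"
    by (simp add: alt_inv_trop_polys_def alt_trace_invariant)
  have "(\<Sum>i = 1..N. inv' g i - 1) = N choose 2" if "g \<in> carrier (alt_group N)" for g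
  proof -
    have "inv' g permutes {1..N}" using that permutes_inv by (auto simp: alt_group_carrier)
    then have "(\<Sum>i = 1..N. inv' g i - 1) = (\<Sum>i = 1..N. i - 1)"
      using sum.permute[of "inv' g" "{1..N}" "\<lambda>i. i - 1"] by (simp add: o_def)
    also have "\<dots> = (\<Sum>i = 0..<N. i)"
      by (rule sum.reindex_bij_witness[of _ Suc "\<lambda>i. i - 1"]) auto
    also have "\<dots> = N choose 2"
      using Sum_Ico_nat[of 0 N] by (simp add: choose_two)
    finally show ?thesis .
  qed
  then have "(\<Sum>i = 1..N. a i) \<le> N choose 2" if "(\<gamma>, a) \<in> ?S" for \<gamma> a
    using that by (elim imageE) simp
  then show "trop_degree N (alt_trace N (z_star N)) \<le> N choose 2"
    by (rule trop_degree_le[OF S alt_trace_z_star_eq_trop_max])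
qed

text \<open>
  If the traces of \<open>x\<close> and \<open>x \<circ> h\<close> agreed, their common value would be the maximum of
  \<open>\<Sum>i. z i * x (g i)\<close> over all permutations \<open>g\<close>, attained at an even and at an odd one. Both would
  sort \<open>x\<close> strictly, so they would be equal.
\<close>

lemma alt_trace_z_star_detects_parity:
  assumes x: "x \<in> Rspace N" and inj: "inj_on x {1..N}"
    and h: "h permutes {1..N}" "\<not> evenperm h"
  shows "alt_trace N (z_star N) (x \<circ> h) \<noteq> alt_trace N (z_star N) x"
proof
  let ?z = "z_star N"
  let ?val = "\<lambda>g. \<Sum>i = 1..N. ?z i * x (g i)"
  assume eq: "alt_trace N ?z (x \<circ> h) = alt_trace N ?z x"
  note xh = Rspace_comp_permutes[OF x h(1)]
  obtain \<sigma> where \<sigma>: "\<sigma> permutes {1..N}" "evenperm \<sigma>" "alt_trace N ?z x = ?val \<sigma>"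
    using alt_trace_attained[OF x] by blast
  obtain g where g: "g permutes {1..N}" "evenperm g"
    "alt_trace N ?z (x \<circ> h) = (\<Sum>i = 1..N. ?z i * (x \<circ> h) (g i))"
    using alt_trace_attained[OF xh] by blast
  define \<rho> where "\<rho> = h \<circ> g"
  have \<rho>: "\<rho> permutes {1..N}" "\<not> evenperm \<rho>"
    using g(2) h(2) permutes_compose[OF g(1) h(1)] evenperm_comp_permutes[OF h(1) g(1)]
    by (simp_all add: \<rho>_def)
  have \<rho>_val: "?val \<rho> = alt_trace N ?z x"
    using g(3) eq by (simp add: \<rho>_def)
  have max: "?val p \<le> alt_trace N ?z x" if p: "p permutes {1..N}" for p
  proof (cases "evenperm p")
    case True
    then show ?thesis using alt_trace_ge[OF x p] by blast
  next
    case False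
    (* An odd permutation is h composed with an even one, so it is seen by the trace of x o h. *)
    have "inv' h \<circ> p permutes {1..N}" "evenperm (inv' h \<circ> p)"
      using permutes_compose[OF p permutes_inv[OF h(1)]] h(2) False
        evenperm_comp_permutes[OF permutes_inv[OF h(1)] p] evenperm_inv_permutes[OF h(1)]
      by simp_all
    from alt_trace_ge[OF xh this, of ?z] show ?thesis
      using eq by (simp add: permutes_inverses(1)[OF h(1)])
  qed
  have sorted: "x (p i) < x (p j)"
    if p: "p permutes {1..N}" "?val p = alt_trace N ?z x"
      and ij: "i \<in> {1..N}" "j \<in> {1..N}" "i < j" for p i j
  proof -
    have "x (p i) \<le> x (p j)"
    proof (rule rearrangement_maximizer_sorted[OF _ p(1)])
      show "?val q \<le> ?val p" if "q permutes {1..N}" for q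
        unfolding p(2) using that by (rule max)
      show "?z i < ?z j" using ij by (simp add: z_star_def)
    qed (use ij in simp_all)
    moreover have "p i \<in> {1..N}" "p j \<in> {1..N}" "p i \<noteq> p j"
      using ij permutes_in_image[OF p(1)] inj_eq[OF permutes_inj[OF p(1)]] by simp_all
    then have "x (p i) \<noteq> x (p j)"
      using inj by (simp add: inj_on_eq_iff)
    ultimately show ?thesis by simp
  qed
  have "\<sigma> = \<rho>"
    by (rule strictly_increasing_arrangement_unique[OF \<sigma>(1) \<rho>(1)
          sorted[OF \<sigma>(1) \<sigma>(3)[symmetric]] sorted[OF \<rho>(1) \<rho>_val]])
  then show False using \<sigma>(2) \<rho>(2) by simp
qed

section \<open>The attaining family\<close>

definition attaining_family :: "nat \<Rightarrow> ((nat \<Rightarrow> real) \<Rightarrow> real) set" where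
  "attaining_family N = trop_esym N ` {1..N} \<union> {alt_trace N (z_star N)}"

lemma attaining_family_separates: "separates_orbits N (attaining_family N)"
  unfolding separates_orbits_def orbit_alt_group_iff
proof (intro ballI impI)
  fix x y assume x: "x \<in> Rspace N" and y: "y \<in> Rspace N"
    and eq: "\<forall>f \<in> attaining_family N. f x = f y"
  have "trop_esym N k x = trop_esym N k y" if "k \<in> {1..N}" for k
    using eq that unfolding attaining_family_def by blast
  from trop_esym_determines_symmetric_orbit[OF x y this]
  obtain h where h: "h permutes {1..N}" "y = x \<circ> h" by blast
  show "\<exists>p. p permutes {1..N} \<and> evenperm p \<and> y = x \<circ> p"
  proof (cases "evenperm h")
    case True
    then show ?thesis using h by (intro exI[of _ h]) simp
  next
    case odd: False
    have "alt_trace N (z_star N) (x \<circ> h) = alt_trace N (z_star N) x"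
      using eq unfolding attaining_family_def h(2) by simp
    then have "\<not> inj_on x {1..N}"
      using alt_trace_z_star_detects_parity[OF x _ h(1) odd] by metis
    then obtain i j where ij: "i \<in> {1..N}" "j \<in> {1..N}" "i \<noteq> j" "x i = x j"
      unfolding inj_on_def by blast
    define \<tau> where "\<tau> = Transposition.transpose i j"
    have \<tau>: "\<tau> permutes {1..N}" "\<not> evenperm \<tau>"
      using ij by (auto simp: \<tau>_def permutes_swap_id evenperm_swap)
    have "x (\<tau> k) = x k" for k
      using ij(4) by (simp add: \<tau>_def Transposition.transpose_def)
    then have "y = x \<circ> (\<tau> \<circ> h)"
      by (simp add: h(2) fun_eq_iff)
    moreover have "\<tau> \<circ> h permutes {1..N}" using h(1) \<tau>(1) by (rule permutes_compose)
    moreover have "evenperm (\<tau> \<circ> h)" using odd \<tau>(2) evenperm_comp_permutes[OF \<tau>(1) h(1)] by simp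
    ultimately show ?thesis by (intro exI[of _ "\<tau> \<circ> h"] conjI)
  qed
qed

lemma attaining_family_poly_invariant: "attaining_family N \<subseteq> alt_inv_trop_polys N"
  unfolding attaining_family_def
  using trop_esym_poly_invariant_degree(1) alt_trace_z_star_poly_invariant_degree(1) by blast

lemma attaining_family_degree:
  assumes "f \<in> attaining_family N"
  shows "trop_degree N f \<le> max N (N choose 2)"
proof -
  consider k where "k \<in> {1..N}" "f = trop_esym N k" | "f = alt_trace N (z_star N)"
    using assms unfolding attaining_family_def by blast
  then show ?thesis
  proof cases
    case 1
    then show ?thesis using trop_esym_poly_invariant_degree(2)[of k N] by (simp add: le_max_iff_disj)
  next
    case 2
    then show ?thesis
      using alt_trace_z_star_poly_invariant_degree(2)[of N] by (simp add: le_max_iff_disj)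
  qed
qed

text \<open>
  The \<open>\<epsilon>\<^sub>k\<close> are told apart by their values \<open>k\<close> at \<open>(1, \<dots>, 1)\<close>, and they all take the value \<open>1\<close> at every
  unit vector. For \<open>N \<ge> 3\<close> the trace is at least \<open>N - 1 > 1\<close> at the last unit vector. For smaller \<open>N\<close>
  the alternating group is trivial, so the trace is \<open>0\<close> or the second coordinate and vanishes at the
  first unit vector.
\<close>

lemma card_attaining_family:
  assumes "N > 0"
  shows "card (attaining_family N) = N + 1"
proof -
  define ones :: "nat \<Rightarrow> real" where "ones = (\<lambda>i \<in> {1..N}. 1)"
  define e :: "nat \<Rightarrow> nat \<Rightarrow> real" where "e = (\<lambda>n. \<lambda>i \<in> {1..N}. if i = n then 1 else 0)"
  have ones: "ones \<in> Rspace N" by (simp add: ones_def Rspace_def)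
  have e: "e n \<in> Rspace N" for n by (simp add: e_def Rspace_def)
  have esym_ones: "trop_esym N k ones = real k" if "k \<in> {1..N}" for k
    using trop_esym_decreasing[OF ones that] that by (simp add: ones_def)
  have esym_e: "trop_esym N k (e n) = 1" if k: "k \<in> {1..N}" and n: "n \<in> {1..N}" for k n
  proof -
    (* Among the unit vectors only e 1 is decreasing, so symmetry is used to reduce to it. *)
    let ?\<tau> = "Transposition.transpose 1 n"
    have \<tau>: "?\<tau> permutes {1..N}" using n assms by (intro permutes_swap_id) auto
    have "e n = e 1 \<circ> ?\<tau>"
      using n assms by (auto simp: e_def fun_eq_iff Transposition.transpose_def)
    then have "trop_esym N k (e n) = trop_esym N k (e 1)"
      using trop_esym_permute[OF e \<tau>] by simp
    also have "\<dots> = (\<Sum>i = 1..k. e 1 i)"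
      by (rule trop_esym_decreasing[OF e k]) (auto simp: e_def)
    also have "\<dots> = (\<Sum>i = 1..k. if i = 1 then 1 else 0)"
      using k by (intro sum.cong) (auto simp: e_def)
    also have "\<dots> = 1" using k by simp
    finally show ?thesis .
  qed
  have z_e: "(\<Sum>i = 1..N. z_star N i * e n (id i)) = real n - 1" if "n \<in> {1..N}" for n
  proof -
    have "(\<Sum>i = 1..N. z_star N i * e n (id i)) = (\<Sum>i = 1..N. if i = n then real n - 1 else 0)"
      by (intro sum.cong) (auto simp: e_def z_star_def)
    then show ?thesis using that by simp
  qed
  have "alt_trace N (z_star N) \<noteq> trop_esym N k" if k: "k \<in> {1..N}" for k
  proof (cases "N \<ge> 3")
    case True
    have "1 < alt_trace N (z_star N) (e N)"
      using alt_trace_ge[OF e[of N] permutes_id, of "z_star N"] z_e[of N] True by simp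
    then show ?thesis using esym_e[OF k, of N] assms by auto
  next
    case False
    have g_id: "g = id" if g: "g permutes {1..N}" "evenperm g" for g
    proof -
      consider "N = 1" | "N = 2" using False assms by linarith
      then show ?thesis
      proof cases
        case 1
        then show ?thesis using g(1) by simp
      next
        case 2
        have "{1..2} = {1, 2 :: nat}" by auto
        then have "g permutes {1, 2}" using g(1) 2 by simp
        then show ?thesis using g(2) by (auto simp: permutes_doubleton_iff evenperm_swap)
      qed
    qed
    obtain g where g: "g permutes {1..N}" "evenperm g"
      "alt_trace N (z_star N) (e 1) = (\<Sum>i = 1..N. z_star N i * e 1 (g i))"
      using alt_trace_attained[OF e] by blast
    then have "alt_trace N (z_star N) (e 1) = 0"
      using z_e[of 1] assms unfolding g(3) g_id[OF g(1,2)] by simp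
    then show ?thesis using esym_e[OF k, of 1] assms by auto
  qed
  then have "alt_trace N (z_star N) \<notin> trop_esym N ` {1..N}" by blast
  moreover have "inj_on (trop_esym N) {1..N}"
    by (rule inj_onI) (metis esym_ones of_nat_eq_iff)
  ultimately show ?thesis by (simp add: attaining_family_def card_image)
qed

section \<open>Generating families\<close>

lemma trop_poly_imp_rational:
  assumes "trop_poly m f"
  shows "trop_rational m f"
proof -
  define q where "q = trop_max m {(0, \<lambda>_. 0)}"
  have q: "trop_poly m q"
    unfolding q_def trop_poly_def by (rule exI[of _ "{(0, \<lambda>_. 0)}"]) simp
  obtain S where S: "f = trop_max m S" using assms unfolding trop_poly_def by blast
  have "f = (\<lambda>z \<in> Rspace m. f z - q z)"
  proof
    fix z show "f z = (\<lambda>z \<in> Rspace m. f z - q z) z"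
      by (cases "z \<in> Rspace m") (simp_all add: S q_def trop_max_def)
  qed
  then show ?thesis
    unfolding trop_rational_def using assms q by (intro exI[of _ f] exI[of _ q] conjI)
qed

text \<open>
  Each function of the attaining family factors through finitely many members of a generating
  family. Points on which the generating family agrees are therefore not told apart by the attaining
  family, which separates orbits.
\<close>

lemma generating_imp_separating:
  assumes "generates_invariant_semifield N F"
  shows "separates_orbits N F"
proof -
  have agree: "f x = f y"
    if x: "x \<in> Rspace N" and y: "y \<in> Rspace N" and eq: "\<forall>f \<in> F. f x = f y"
      and f: "f \<in> attaining_family N" for x y f
  proof -
    have "f \<in> alt_inv_trop_polys N" using f attaining_family_poly_invariant by blast
    then have rational: "trop_rational N f" and invariant: "alt_invariant N f"
      using trop_poly_imp_rational by (simp_all add: alt_inv_trop_polys_def)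
    from assms[unfolded generates_invariant_semifield_def, THEN spec, THEN mp,
        OF conjI[OF rational invariant]]
    show ?thesis
    proof (elim exE conjE)
      fix k fs g
      assume "\<forall>i \<in> {1..k}. fs i \<in> F"
      then have "(\<lambda>i \<in> {1..k}. fs i x) = (\<lambda>i \<in> {1..k}. fs i y)"
        using eq by (intro restrict_ext) blast
      moreover assume "f = (\<lambda>x \<in> Rspace N. g (\<lambda>i \<in> {1..k}. fs i x))"
      ultimately show ?thesis using x y by simp
    qed
  qed
  show ?thesis
    unfolding separates_orbits_def
  proof (intro ballI impI)
    fix x y assume xy: "x \<in> Rspace N" "y \<in> Rspace N" "\<forall>f \<in> F. f x = f y"
    then have "\<forall>f \<in> attaining_family N. f x = f y" using agree by simp
    then show "y \<in> orbit (alt_group N) perm_act x"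
      using attaining_family_separates[unfolded separates_orbits_def] xy(1,2) by simp
  qed
qed

theorem corollary4p9:
  fixes N :: nat
  assumes "N > 0"
  shows "(\<forall>F. F \<subseteq> alt_inv_trop_polys N \<and> separates_orbits N F \<longrightarrow>
             (\<exists>f \<in> F. trop_degree N f \<ge> N choose 2)) \<and>
         (\<forall>F. F \<subseteq> alt_inv_trop_polys N \<and> generates_invariant_semifield N F \<longrightarrow>
             separates_orbits N F \<and> (\<exists>f \<in> F. trop_degree N f \<ge> N choose 2)) \<and>
         (let E = trop_esym N ` {1..N} \<union> {alt_trace N (z_star N)} in
             card E = N + 1 \<and> E \<subseteq> alt_inv_trop_polys N \<and> separates_orbits N E \<and>
             (\<forall>f \<in> E. trop_degree N f \<le> max N (N choose 2)))"
  unfolding attaining_family_def[symmetric] Let_def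
proof (intro conjI allI impI ballI)
  fix F assume "F \<subseteq> alt_inv_trop_polys N \<and> separates_orbits N F"
  then show "\<exists>f \<in> F. trop_degree N f \<ge> N choose 2"
    using separating_family_has_high_degree[OF assms] by simp
next
  fix F assume F: "F \<subseteq> alt_inv_trop_polys N \<and> generates_invariant_semifield N F"
  then show "separates_orbits N F" using generating_imp_separating by simp
  then show "\<exists>f \<in> F. trop_degree N f \<ge> N choose 2"
    using separating_family_has_high_degree[OF assms] F by simp
qed (rule card_attaining_family[OF assms] attaining_family_poly_invariant
    attaining_family_separates attaining_family_degree; assumption?)+

end
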